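(* Let $a_1\in\mathbb{R}$ and consider the two-stage stochastic Runge-Kutta (SRK) scheme ($s=2$) with coefficients $$A=\begin{pmatrix} a_1&0\\ a_2&1-a_2\end{pmatrix},\qquad B^{(1)}=\begin{pmatrix}0&0\\1&0\end{pmatrix},\qquad B^{(2)}=B^{(3)}=0,$$ where $a_2=0$. This (strong order 0.5) scheme is $A$-stable for the linear test equation $\mathrm{d}X_t=\lambda X_t\,\mathrm{d}t+\mu X_t\,\mathrm{d}W_t$ ($\lambda,\mu\in\mathbb{C}$), i.e. $\mathcal{D}_{SDE}\subseteq\mathcal{D}_{SRK}$, if and only if $a_1\ge 0$.
   Context: A stiffly accurate $s$-stage SRK method with real $s\times s$ coefficient matrices $A,B^{(1)},B^{(2)},B^{(3)}$, applied with constant step size $h>0$ to the scalar test equation $\mathrm{d}X_t=\lambda X_t\,\mathrm{d}t+\mu X_t\,\mathrm{d}W_t$ ($W$ a real Wiener process, Itô sense, $\lambda,\mu\in\mathbb{C}$), computes stages $H=(H_1,\dots,H_s)^T$ from $$H=e\,y_n+\lambda hAH+\mu\Big(I_{(1),n}B^{(1)}+\tfrac{I_{(1,1),n}}{\sqrt h}B^{(2)}+\sqrt h\,B^{(3)}\Big)H,\qquad y_{n+1}=H_s,$$ where $e=(1,\dots,1)^T\in\mathbb{R}^s$, $I_{(1),n}=\sqrt h\,\xi_n$ with $\xi_n\sim N(0,1)$ independent, and $I_{(1,1),n}=\frac12(I_{(1),n}^2-h)$. With $\hat h=\lambda h$ and $k=\mu\sqrt h$ this gives $y_{n+1}=R_n(\hat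 h,k)\,y_n$, with stability function $$R_n(\hat h,k)=\varepsilon_s^T\Big(I_s-\hat hA-k\big(\xi_nB^{(1)}+\tfrac12(\xi_n^2-1)B^{(2)}+B^{(3)}\big)\Big)^{-1}e,\qquad \varepsilon_s=(0,\dots,0,1)^T\in\mathbb{R}^s,$$ $I_s$ the identity matrix, defined wherever the inverse exists. Put $\hat R(\hat h,k)=\mathrm{E}(|R_n(\hat h,k)|^2)$. Domains of mean-square stability: $\mathcal{D}_{SDE}=\{(\lambda,\mu)\in\mathbb{C}^2: 2\Re(\lambda)+|\mu|^2<0\}$ and $\mathcal{D}_{SRK}=\{(\hat h,k)\in\mathbb{C}^2:\hat R(\hat h,k)<1\}$. The method is called $A$-stable if $\mathcal{D}_{SDE}\subseteq\mathcal{D}_{SRK}$, i.e. if $\hat R(\hat h,k)<1$ for all $(\hat h,k)\in\mathbb{C}^2$ with $2\Re(\hat h)+|k|^2<0$. *)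

theory Defs
  imports "HOL-Probability.Probability"
begin

(* The stage indices 1,...,s are the elements of the finite type 's. The index of the
   last stage is part of the method: in the type 2 used for two stages, the index 2
   equals 0 and hence is not the greatest element of the built-in order. *)
record 's srk =
  srk_A :: "real ^ 's ^ 's"
  srk_B1 :: "real ^ 's ^ 's"
  srk_B2 :: "real ^ 's ^ 's"
  srk_B3 :: "real ^ 's ^ 's"
  srk_last :: 's

definition cmatrix :: "real ^ 'n ^ 'm \<Rightarrow> complex ^ 'n ^ 'm" where
  "cmatrix P = (\<chi> i j. complex_of_real (P $ i $ j))"

(* One step for dX = l X dt + m X dW with step size h and Wiener increment sqrt h * x:
   the stages H satisfy the implicit system; the new value is the last stage. *)
definition srk_step ::
    "'s::finite srk \<Rightarrow> complex \<Rightarrow> complex \<Rightarrow> real \<Rightarrow> real \<Rightarrow> complex \<Rightarrow> complex ^ 's \<Rightarrow> complex \<Rightarrow> bool" where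
  "srk_step S l m h x y H y' \<longleftrightarrow>
     (let I1 = sqrt h * x; I11 = (I1\<^sup>2 - h) / 2 in
      H = y *s vec 1 + (l * of_real h) *s (cmatrix (srk_A S) *v H)
          + m *s (cmatrix (I1 *\<^sub>R srk_B1 S + (I11 / sqrt h) *\<^sub>R srk_B2 S
                           + sqrt h *\<^sub>R srk_B3 S) *v H)
      \<and> y' = H $ srk_last S)"

(* mat c is c times the identity matrix. *)
definition srk_matrix ::
    "'s::finite srk \<Rightarrow> complex \<Rightarrow> complex \<Rightarrow> real \<Rightarrow> complex ^ 's ^ 's" where
  "srk_matrix S z k x =
     mat 1 - mat z ** cmatrix (srk_A S)
       - mat k ** cmatrix (x *\<^sub>R srk_B1 S + ((x\<^sup>2 - 1) / 2) *\<^sub>R srk_B2 S + srk_B3 S)"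

(* Meaningful only where srk_matrix is invertible. *)
definition stability_function ::
    "'s::finite srk \<Rightarrow> complex \<Rightarrow> complex \<Rightarrow> real \<Rightarrow> complex" where
  "stability_function S z k x = (matrix_inv (srk_matrix S z k x) *v vec 1) $ srk_last S"

(* The expectation is extended-real valued, so that an infinite second moment is not
   mistaken for 0. *)
definition ms_stability_function ::
    "'w measure \<Rightarrow> ('w \<Rightarrow> real) \<Rightarrow> 's::finite srk \<Rightarrow> complex \<Rightarrow> complex \<Rightarrow> ennreal" where
  "ms_stability_function M X S z k =
     (\<integral>\<^sup>+ w. ennreal ((cmod (stability_function S z k (X w)))\<^sup>2) \<partial>M)"

definition D_SDE :: "(complex \<times> complex) set" where
  "D_SDE = {(l, m). 2 * Re l + (cmod m)\<^sup>2 < 0}"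

(* The stability function has to be defined almost surely for its second moment
   to make sense. *)
definition D_SRK :: "'w measure \<Rightarrow> ('w \<Rightarrow> real) \<Rightarrow> 's::finite srk \<Rightarrow> (complex \<times> complex) set" where
  "D_SRK M X S =
     {(z, k). (AE w in M. invertible (srk_matrix S z k (X w))) \<and> ms_stability_function M X S z k < 1}"

definition A_stable :: "'w measure \<Rightarrow> ('w \<Rightarrow> real) \<Rightarrow> 's::finite srk \<Rightarrow> bool" where
  "A_stable M X S \<longleftrightarrow> D_SDE \<subseteq> D_SRK M X S"

definition two_stage_srk :: "real \<Rightarrow> real \<Rightarrow> 2 srk" where
  "two_stage_srk a1 a2 =
     \<lparr> srk_A = vector [vector [a1, 0], vector [a2, 1 - a2]],
       srk_B1 = vector [vector [0, 0], vector [1, 0]],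
       srk_B2 = 0,
       srk_B3 = 0,
       srk_last = 2 \<rparr>"

lemma mat_mult_vec: "(mat c ** P) *v v = c *s (P *v v)"
  for P :: "complex ^ 'n::finite ^ 'm::finite"
  by (simp add: vec_eq_iff matrix_vector_mult_def matrix_matrix_mult_def mat_def if_distrib
      if_distribR sum.delta sum_distrib_left mult.assoc cong: if_cong)

(* The recursion y' = R y that justifies the definition of the stability function. *)
lemma srk_step_iff:
  fixes S :: "'s::finite srk"
  assumes h: "h > 0"
    and inv: "invertible (srk_matrix S (l * of_real h) (m * of_real (sqrt h)) x)"
  shows "(\<exists>H. srk_step S l m h x y H y') \<longleftrightarrow>
         y' = stability_function S (l * of_real h) (m * of_real (sqrt h)) x * y"
proof -
  define P where "P = srk_matrix S (l * of_real h) (m * of_real (sqrt h)) x"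
  define B where "B = x *\<^sub>R srk_B1 S + ((x\<^sup>2 - 1) / 2) *\<^sub>R srk_B2 S + srk_B3 S"
  have sq: "((sqrt h * x)\<^sup>2 - h) / 2 / sqrt h = sqrt h * ((x\<^sup>2 - 1) / 2)"
  proof -
    have "sqrt h * sqrt h = h" using h by simp
    then have "((sqrt h * x)\<^sup>2 - h) / 2 = sqrt h * (sqrt h * ((x\<^sup>2 - 1) / 2))"
      by (simp add: power2_eq_square algebra_simps)
    then show ?thesis using h by simp
  qed
  have "(sqrt h * x) *\<^sub>R srk_B1 S + (((sqrt h * x)\<^sup>2 - h) / 2 / sqrt h) *\<^sub>R srk_B2 S
          + sqrt h *\<^sub>R srk_B3 S = sqrt h *\<^sub>R B"
    unfolding sq B_def by (simp add: scaleR_add_right)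
  moreover have "cmatrix (sqrt h *\<^sub>R B) *v H = of_real (sqrt h) *s (cmatrix B *v H)" for H
    by (simp add: vec_eq_iff cmatrix_def matrix_vector_mult_def sum_distrib_left mult.assoc)
  ultimately have step: "srk_step S l m h x y H y' \<longleftrightarrow> P *v H = y *s vec 1 \<and> y' = H $ srk_last S" for H
    unfolding srk_step_def Let_def P_def srk_matrix_def B_def[symmetric]
    by (auto simp: matrix_vector_mult_diff_rdistrib mat_mult_vec algebra_simps vector_smult_assoc)
  have inv1: "matrix_inv P ** P = mat 1" "P ** matrix_inv P = mat 1"
    using someI_ex[OF inv[unfolded invertible_def]] unfolding P_def matrix_inv_def by auto
  have sol: "P *v H = y *s vec 1 \<longleftrightarrow> H = matrix_inv P *v (y *s vec 1)" for H
    by (metis inv1 matrix_vector_mul_assoc matrix_vector_mul_lid)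
  have "matrix_inv P *v (y *s vec 1) = y *s (matrix_inv P *v vec 1)"
    by (simp add: vec_eq_iff matrix_vector_mult_def sum_distrib_left mult_ac)
  then show ?thesis
    unfolding step sol stability_function_def P_def[symmetric] by (auto simp: mult.commute)
qed

end

theory Submission
  imports Defs
begin

text \<open>
  Solving the two stages gives \<open>R = (1 + k \<xi> / (1 - a1 z)) / (1 - z)\<close>, whose second moment is
  \<open>(1 + |k|\<^sup>2 / |1 - a1 z|\<^sup>2) / |1 - z|\<^sup>2\<close>. On the domain \<open>2 Re z + |k|\<^sup>2 < 0\<close> the denominator
  satisfies \<open>|1 - z|\<^sup>2 > 1 + |k|\<^sup>2\<close>, and \<open>|1 - a1 z| \<ge> 1\<close> if \<open>a1 \<ge> 0\<close>. If \<open>a1 < 0\<close>, then the point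
  \<open>z = 1 / a1\<close>, \<open>k = 0\<close> belongs to the domain, but there the stage system is singular.
\<close>

lemma one_le_cmod_one_minus:
  assumes "Re w \<le> 0"
  shows "1 \<le> cmod (1 - w)"
  using complex_Re_le_cmod[of "1 - w"] assms by simp

text \<open>The squared modulus is a real quadratic polynomial in \<open>x\<close>, so only the
  normal moments of order 0, 1 and 2 enter. They are 1, 0 and 1, hence the cross term
  vanishes.\<close>

lemma has_bochner_integral_std_normal_affine_square:
  fixes u v :: complex
  shows "has_bochner_integral lborel
           (\<lambda>x. std_normal_density x * (cmod (u + v * of_real x))\<^sup>2) ((cmod u)\<^sup>2 + (cmod v)\<^sup>2)"
proof -
  \<comment> \<open>The exponents stay in the shapes \<open>2 * j\<close> and
    \<open>2 * j + 1\<close> so that the even and odd moment rules apply literally.\<close>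
  have eq: "std_normal_density x * (cmod (u + v * of_real x))\<^sup>2
      = std_normal_density x * x ^ (2 * 0) * (cmod u)\<^sup>2
        + std_normal_density x * x ^ (2 * 0 + 1) * (2 * (Re u * Re v + Im u * Im v))
        + std_normal_density x * x ^ (2 * 1) * (cmod v)\<^sup>2" for x
    unfolding cmod_power2 by (simp add: power2_eq_square algebra_simps)
  have "has_bochner_integral lborel
     (\<lambda>x. std_normal_density x * (cmod (u + v * of_real x))\<^sup>2)
     (fact (2 * 0) / (2 ^ 0 * fact 0) * (cmod u)\<^sup>2 + 0 * (2 * (Re u * Re v + Im u * Im v))
        + fact (2 * 1) / (2 ^ 1 * fact 1) * (cmod v)\<^sup>2)"
    unfolding eq
    by (intro has_bochner_integral_add has_bochner_integral_mult_left
        std_normal_moment_even std_normal_moment_odd)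
  then show ?thesis
    by (simp add: fact_2)
qed

lemma nn_integral_std_normal_affine_square:
  fixes u v :: complex
  assumes X: "distributed M lborel X std_normal_density"
  shows "(\<integral>\<^sup>+ w. ennreal ((cmod (u + v * of_real (X w)))\<^sup>2) \<partial>M)
           = ennreal ((cmod u)\<^sup>2 + (cmod v)\<^sup>2)"
proof -
  have "(\<integral>\<^sup>+ w. ennreal ((cmod (u + v * of_real (X w)))\<^sup>2) \<partial>M)
      = (\<integral>\<^sup>+ x. ennreal (std_normal_density x) * ennreal ((cmod (u + v * of_real x))\<^sup>2) \<partial>lborel)"
    by (rule distributed_nn_integral[OF X, symmetric]) measurable
  also have "\<dots> = (\<integral>\<^sup>+ x. ennreal (std_normal_density x * (cmod (u + v * of_real x))\<^sup>2) \<partial>lborel)"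
    by (simp add: ennreal_mult)
  also have "\<dots> = ennreal ((cmod u)\<^sup>2 + (cmod v)\<^sup>2)"
    using has_bochner_integral_std_normal_affine_square[of u v]
    by (subst nn_integral_eq_integral) (auto simp: has_bochner_integral_iff)
  finally show ?thesis .
qed

lemma srk_matrix_two_stage:
  "srk_matrix (two_stage_srk a1 0) z k x
     = vector [vector [1 - a1 * z, 0], vector [- (k * x), 1 - z]]"
  by (simp add: srk_matrix_def two_stage_srk_def cmatrix_def vec_eq_iff forall_2
      matrix_matrix_mult_def mat_def sum_2)

text \<open>The matrix is lower triangular with determinant \<open>(1 - a1 * z) * (1 - z)\<close>;
  the noise sits below the diagonal, so singularity does not depend on \<open>x\<close>.\<close>

lemma invertible_srk_matrix_two_stage:
  "invertible (srk_matrix (two_stage_srk a1 0) z k x) \<longleftrightarrow> a1 * z \<noteq> 1 \<and> z \<noteq> 1"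
  by (auto simp: invertible_det_nz srk_matrix_two_stage det_2)

text \<open>Lets the stability function be found by exhibiting a solution of the stage system
  instead of computing an inverse.\<close>

lemma matrix_inv_mult_vec_eqI:
  fixes P :: "'a::field ^ 'n ^ 'n"
  assumes "invertible P" "P *v v = b"
  shows "matrix_inv P *v b = v"
proof -
  have "matrix_inv P ** P = mat 1"
    using someI_ex[OF assms(1)[unfolded invertible_def]] unfolding matrix_inv_def by auto
  then show ?thesis
    by (metis assms(2) matrix_vector_mul_assoc matrix_vector_mul_lid)
qed

lemma stability_function_two_stage:
  fixes a1 :: real and z :: complex
  assumes "a1 * z \<noteq> 1" "z \<noteq> 1"
  shows "stability_function (two_stage_srk a1 0) z k x
           = 1 / (1 - z) + k / ((1 - a1 * z) * (1 - z)) * x"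
proof -
  \<comment> \<open>The stage values for initial value 1, obtained by forward substitution.\<close>
  define H :: "complex ^ 2" where
    "H = vector [1 / (1 - a1 * z), 1 / (1 - z) + k / ((1 - a1 * z) * (1 - z)) * x]"
  have "1 - a1 * z \<noteq> 0" "1 - z \<noteq> 0"
    using assms by auto
  then have "srk_matrix (two_stage_srk a1 0) z k x *v H = vec 1"
    by (simp add: srk_matrix_two_stage H_def vec_eq_iff forall_2 matrix_vector_mult_def sum_2
        distrib_left)
  then have "matrix_inv (srk_matrix (two_stage_srk a1 0) z k x) *v vec 1 = H"
    using assms by (intro matrix_inv_mult_vec_eqI) (simp_all add: invertible_srk_matrix_two_stage)
  then show ?thesis
    by (simp add: stability_function_def two_stage_srk_def H_def)
qed

lemma ms_stability_function_two_stage: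
  fixes a1 :: real and z :: complex
  assumes "distributed M lborel X std_normal_density" "a1 * z \<noteq> 1" "z \<noteq> 1"
  shows "ms_stability_function M X (two_stage_srk a1 0) z k
           = ennreal ((1 + (cmod k)\<^sup>2 / (cmod (1 - a1 * z))\<^sup>2) / (cmod (1 - z))\<^sup>2)"
  unfolding ms_stability_function_def stability_function_two_stage[OF assms(2,3)]
    nn_integral_std_normal_affine_square[OF assms(1)]
  by (simp add: norm_divide norm_mult power_divide power_mult_distrib add_divide_distrib)

theorem lemma5p1:
  fixes M :: "'w measure" and \<xi> :: "nat \<Rightarrow> 'w \<Rightarrow> real" and n :: nat
    and a1 a2 :: real
  assumes "prob_space M"
    and "prob_space.indep_vars M (\<lambda>_. borel) \<xi> UNIV"
    and "\<And>i. distributed M lborel (\<xi> i) std_normal_density"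
    and "a2 = 0"
  shows "A_stable M (\<xi> n) (two_stage_srk a1 a2) \<longleftrightarrow> a1 \<ge> 0"
proof
  assume stable: "A_stable M (\<xi> n) (two_stage_srk a1 a2)"
  show "a1 \<ge> 0"
  proof (rule ccontr)
    assume "\<not> a1 \<ge> 0"
    then have neg: "a1 < 0" by simp
    then have "(of_real (1 / a1), 0) \<in> D_SDE"
      by (simp add: D_SDE_def)
    then have "(of_real (1 / a1), 0) \<in> D_SRK M (\<xi> n) (two_stage_srk a1 a2)"
      using stable by (auto simp: A_stable_def)
    \<comment> \<open>At this point the stage matrix is singular for every value of the noise, so
      almost sure invertibility is absurd.\<close>
    then have "AE w in M. False"
      using neg \<open>a2 = 0\<close> by (simp add: D_SRK_def invertible_srk_matrix_two_stage)
    with prob_space.AE_False[OF \<open>prob_space M\<close>] show False by simp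
  qed
next
  assume nonneg: "a1 \<ge> 0"
  have "(z, k) \<in> D_SRK M (\<xi> n) (two_stage_srk a1 a2)" if "(z, k) \<in> D_SDE" for z k
  proof -
    have dom: "2 * Re z + (cmod k)\<^sup>2 < 0"
      using that by (simp add: D_SDE_def)
    then have Re_neg: "Re z < 0"
      using zero_le_power2[of "cmod k"] by linarith
    then have Re_a1: "Re (a1 * z) \<le> 0"
      using nonneg by (simp add: mult_nonneg_nonpos)
    \<comment> \<open>Both numbers have nonpositive real part, whereas 1 does not.\<close>
    have ne: "a1 * z \<noteq> 1" "z \<noteq> 1"
      using Re_neg Re_a1 by (metis not_one_le_zero one_complex.simps(1), auto)
    have "1 \<le> (cmod (1 - a1 * z))\<^sup>2"
      using one_le_cmod_one_minus[OF Re_a1] by simp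
    then have "(cmod k)\<^sup>2 / (cmod (1 - a1 * z))\<^sup>2 \<le> (cmod k)\<^sup>2"
      using divide_left_mono[of 1 "(cmod (1 - a1 * z))\<^sup>2" "(cmod k)\<^sup>2"] ne by simp
    also have "\<dots> < - 2 * Re z"
      using dom by simp
    \<comment> \<open>The two sides differ by the squared modulus of \<open>z\<close>.\<close>
    also have "\<dots> \<le> (cmod (1 - z))\<^sup>2 - 1"
      unfolding cmod_power2 by (simp add: power2_eq_square algebra_simps)
    finally have "(1 + (cmod k)\<^sup>2 / (cmod (1 - a1 * z))\<^sup>2) / (cmod (1 - z))\<^sup>2 < 1"
      using ne by (subst divide_less_eq_1_pos) simp_all
    then show ?thesis
      using ne assms(3,4)
      by (simp add: D_SRK_def invertible_srk_matrix_two_stage ms_stability_function_two_stage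
          ennreal_less_one_iff)
  qed
  then show "A_stable M (\<xi> n) (two_stage_srk a1 a2)"
    by (auto simp: A_stable_def)
qed

end
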